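(* Let $n\ge 3$, let $P_n(R)$ be a regular $n$-gon in the Euclidean plane with vertices $A_1,\dots,A_n$, circumradius $R>0$ and centroid $O$, and let $M$ be an arbitrary point of the plane with $L=|MO|$. Then $$R^2=\frac12\left(S_n^{(2)}\pm\sqrt{3\left(S_n^{(2)}\right)^2-2S_n^{(4)}}\right),\qquad L^2=\frac12\left(S_n^{(2)}\mp\sqrt{3\left(S_n^{(2)}\right)^2-2S_n^{(4)}}\right),$$ where the signs correspond: either both upper signs hold or both lower signs hold.
   Context: The cyclic averages are $S_n^{(2m)}=\frac1n\sum_{i=1}^n d_i^{2m}$ with $d_i=|MA_i|$, for $1\le m\le n-1$; here $m=1,2$ are used. *)

theory Defs
  imports "HOL-Analysis.Analysis"
begin

text \<open>A polygon with \<open>n\<close> vertices is given by its vertices \<open>A 0, \<dots>, A (n - 1)\<close> in cyclic order;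
  values of \<open>A\<close> at other indices are irrelevant.\<close>

text \<open>Convexity: all vertices other than the two endpoints of a side lie strictly on one side
  of the line through it. The determinant is twice the signed area of the triangle with vertices
  \<open>A i\<close>, \<open>A (i + 1)\<close>, \<open>A j\<close>. Since \<open>3 \<le> n\<close>, this also forces the vertices to be
  distinct, and it rules out star polygons.\<close>

definition convex_polygon :: "nat \<Rightarrow> (nat \<Rightarrow> real^2) \<Rightarrow> bool" where
  "convex_polygon n A \<longleftrightarrow> 3 \<le> n \<and>
     (\<forall>i<n. let p = A i; q = A ((i + 1) mod n); J = {..<n} - {i, (i + 1) mod n} in
        (\<forall>j\<in>J. det (vector [q - p, A j - p] :: real^2^2) > 0) \<or>
        (\<forall>j\<in>J. det (vector [q - p, A j - p] :: real^2^2) < 0))"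

definition equilateral_polygon :: "nat \<Rightarrow> (nat \<Rightarrow> real^2) \<Rightarrow> bool" where
  "equilateral_polygon n A \<longleftrightarrow>
     (\<exists>s. \<forall>i<n. dist (A i) (A ((i + 1) mod n)) = s)"

text \<open>The unoriented angle at \<open>q\<close> between the rays to \<open>p\<close> and \<open>r\<close>, for \<open>p \<noteq> q\<close> and \<open>r \<noteq> q\<close>.\<close>

definition angle_at :: "real^2 \<Rightarrow> real^2 \<Rightarrow> real^2 \<Rightarrow> real" where
  "angle_at p q r = arccos (((p - q) \<bullet> (r - q)) / (norm (p - q) * norm (r - q)))"

text \<open>For a convex polygon the unoriented angles at the vertices are its interior angles.\<close>

definition equiangular_polygon :: "nat \<Rightarrow> (nat \<Rightarrow> real^2) \<Rightarrow> bool" where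
  "equiangular_polygon n A \<longleftrightarrow>
     (\<exists>a. \<forall>i<n. angle_at (A i) (A ((i + 1) mod n)) (A ((i + 2) mod n)) = a)"

definition regular_polygon :: "nat \<Rightarrow> (nat \<Rightarrow> real^2) \<Rightarrow> bool" where
  "regular_polygon n A \<longleftrightarrow>
     convex_polygon n A \<and> equilateral_polygon n A \<and> equiangular_polygon n A"

definition has_circumradius :: "nat \<Rightarrow> (nat \<Rightarrow> real^2) \<Rightarrow> real \<Rightarrow> bool" where
  "has_circumradius n A R \<longleftrightarrow> (\<exists>c. \<forall>i<n. dist c (A i) = R)"

definition centroid :: "nat \<Rightarrow> (nat \<Rightarrow> real^2) \<Rightarrow> real^2" where
  "centroid n A = (1 / real n) *\<^sub>R (\<Sum>i<n. A i)"

text \<open>\<open>cyclic_average n A M m\<close> is $S_n^{(2m)}$: the last argument is half the exponent.\<close>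

definition cyclic_average :: "nat \<Rightarrow> (nat \<Rightarrow> real^2) \<Rightarrow> real^2 \<Rightarrow> nat \<Rightarrow> real" where
  "cyclic_average n A M m = (1 / real n) * (\<Sum>i<n. dist M (A i) ^ (2 * m))"

end

theory Submission
  imports Defs
begin

text \<open>
  On the circumscribed circle, an equilateral polygon with \<open>A i \<noteq> A (i + 2)\<close> moves by a constant
  rotation \<open>\<omega>\<close> from each vertex to the next: the two neighbours of a vertex are distinct points
  of the circle at the same distance from it, hence mirror images. Here \<open>\<omega>\<close> is an \<open>n\<close>-th root
  of unity with \<open>\<omega>\<^sup>2 \<noteq> 1\<close>, so the vertices, taken relative to the circumcentre, and their squares
  sum to zero. This yields \<open>S2 = R\<^sup>2 + L\<^sup>2\<close> and \<open>S4 = (R\<^sup>2 + L\<^sup>2)\<^sup>2 + 2 R\<^sup>2 L\<^sup>2\<close>, so that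
  \<open>3 S2\<^sup>2 - 2 S4 = (R\<^sup>2 - L\<^sup>2)\<^sup>2\<close>.
\<close>

text \<open>Passing to complex numbers turns a rotation about the circumcentre into a
  multiplication.\<close>

definition complex_of_vec :: "real^2 \<Rightarrow> complex" where
  "complex_of_vec v = Complex (v $ 1) (v $ 2)"

lemma norm_complex_of_vec: "cmod (complex_of_vec v) = norm v"
  by (simp add: complex_of_vec_def complex_norm norm_vec_def L2_set_def sum_2)

lemma linear_complex_of_vec: "linear complex_of_vec"
  by (rule linearI) (simp_all add: complex_of_vec_def complex_eq_iff)

lemma dist_complex_of_vec: "dist u v = cmod (complex_of_vec u - complex_of_vec v)"
  by (simp add: dist_norm norm_complex_of_vec flip: linear_diff[OF linear_complex_of_vec])

lemma inj_complex_of_vec: "complex_of_vec u = complex_of_vec v \<longleftrightarrow> u = v"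
  by (auto simp: complex_of_vec_def vec_eq_iff forall_2)

lemma cmod_diff_squared:
  "(cmod (x - y))\<^sup>2 = (cmod x)\<^sup>2 + (cmod y)\<^sup>2 - 2 * Re (x * cnj y)"
  unfolding cmod_power2 by (simp add: power2_eq_square algebra_simps)

text \<open>Multiplication by \<open>cnj v\<close> turns the direction of \<open>v\<close> onto the
  real axis. By the cosine rule the images \<open>t\<close> and \<open>t'\<close> of
  \<open>u\<close> and \<open>w\<close> have equal real parts; their moduli agree too, so their
  imaginary parts agree up to sign. Being distinct, they are conjugate, and their product is
  \<open>R ^ 4\<close>.\<close>

lemma circle_neighbours_mult:
  fixes u v w :: complex
  assumes norms: "cmod u = R" "cmod v = R" "cmod w = R"
    and dists: "cmod (u - v) = s" "cmod (w - v) = s" and "u \<noteq> w"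
  shows "u * w = v\<^sup>2"
proof (cases "v = 0")
  case True
  then show ?thesis using norms by auto
next
  case False
  define t t' where "t = u * cnj v" and "t' = w * cnj v"
  have "t \<noteq> t'" using False \<open>u \<noteq> w\<close> by (simp add: t_def t'_def)
  have vv: "v * cnj v = of_real (R\<^sup>2)"
    using norms(2) complex_norm_square[of v] by simp
  have "Re t = Re t'"
    using cmod_diff_squared[of u v] cmod_diff_squared[of w v] norms dists
    by (simp add: t_def t'_def)
  moreover have tt: "cmod t = R\<^sup>2" "cmod t' = R\<^sup>2"
    using norms by (simp_all add: t_def t'_def norm_mult power2_eq_square)
  ultimately have "(Im t)\<^sup>2 = (Im t')\<^sup>2"
    using cmod_power2[of t] cmod_power2[of t'] by simp
  with \<open>Re t = Re t'\<close> \<open>t \<noteq> t'\<close> have "t' = cnj t"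
    by (auto simp: complex_eq_iff power2_eq_iff)
  then have "t * t' = of_real ((R\<^sup>2)\<^sup>2)"
    using tt(1) complex_norm_square[of t] by simp
  also have "\<dots> = (v * cnj v)\<^sup>2" by (simp add: vv)
  finally have "u * w * (cnj v)\<^sup>2 = v\<^sup>2 * (cnj v)\<^sup>2"
    by (simp add: t_def t'_def power2_eq_square mult_ac)
  then show ?thesis using False by simp
qed

lemma geometric_of_mult_eq_square:
  fixes w :: "nat \<Rightarrow> 'a::field"
  assumes nz: "\<And>i. w i \<noteq> 0" and mult: "\<And>i. w i * w (i + 2) = (w (i + 1))\<^sup>2"
  shows "w i = w 0 * (w 1 / w 0) ^ i"
proof -
  have ratio: "w (Suc i) / w i = w 1 / w 0" for i
  proof (induction i)
    case (Suc i)
    have "w (Suc (Suc i)) / w (Suc i) = w (Suc i) / w i"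
      using mult[of i] nz[of i] nz[of "Suc i"] by (simp add: field_simps power2_eq_square)
    with Suc show ?case by simp
  qed simp
  show ?thesis
  proof (induction i)
    case (Suc i)
    have "w (Suc i) = w i * (w 1 / w 0)"
      using ratio[of i] nz[of i] by (simp add: field_simps)
    with Suc show ?case by (simp add: mult_ac)
  qed simp
qed

lemma sum_powers_root_of_unity:
  fixes q :: "'a::field"
  assumes "q ^ n = 1" "q \<noteq> 1"
  shows "(\<Sum>i<n. q ^ i) = 0"
  using assms by (simp add: sum_gp_strict)

text \<open>Each squared distance is \<open>T - 2 * r i\<close>, affine in \<open>r i\<close>, so
  both moments reduce to the sums of \<open>r i\<close> and of its square. The first vanishes by
  \<open>sum1\<close>; the second is governed by \<open>sum2\<close>.\<close>

lemma circle_moments: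
  fixes z :: "nat \<Rightarrow> complex"
  assumes R: "\<And>i. i < n \<Longrightarrow> cmod (z i) = R"
    and sum1: "(\<Sum>i<n. z i) = 0" and sum2: "(\<Sum>i<n. (z i)\<^sup>2) = 0"
  shows "(\<Sum>i<n. cmod (m - z i) ^ 2) = n * (R\<^sup>2 + (cmod m)\<^sup>2)"
    and "(\<Sum>i<n. cmod (m - z i) ^ 4) =
           n * ((R\<^sup>2 + (cmod m)\<^sup>2)\<^sup>2 + 2 * R\<^sup>2 * (cmod m)\<^sup>2)"
proof -
  define r where "r i = Re (z i * cnj m)" for i
  define T where "T = R\<^sup>2 + (cmod m)\<^sup>2"
  have d: "cmod (m - z i) ^ 2 = T - 2 * r i" if "i < n" for i
    using cmod_diff_squared[of "z i" m] R[OF that]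
    by (simp add: r_def T_def norm_minus_commute)
  have "(\<Sum>i<n. r i) = Re ((\<Sum>i<n. z i) * cnj m)"
    unfolding r_def by (simp only: Re_sum sum_distrib_right)
  then have r1: "(\<Sum>i<n. r i) = 0" by (simp add: sum1)
  have rsq: "(r i)\<^sup>2 = (R\<^sup>2 * (cmod m)\<^sup>2 + Re ((z i)\<^sup>2 * (cnj m)\<^sup>2)) / 2" if "i < n" for i
  proof -
    \<comment> \<open>This is the double-angle formula for the cosine; it is what brings in the
      squares of the \<open>z i\<close>.\<close>
    have sq: "(Re x)\<^sup>2 = ((cmod x)\<^sup>2 + Re (x\<^sup>2)) / 2" for x
      unfolding cmod_power2 by (simp add: power2_eq_square)
    show ?thesis using sq[of "z i * cnj m"] R[OF that]
      by (simp add: r_def norm_mult power_mult_distrib)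
  qed
  have "(\<Sum>i<n. Re ((z i)\<^sup>2 * (cnj m)\<^sup>2)) = Re ((\<Sum>i<n. (z i)\<^sup>2) * (cnj m)\<^sup>2)"
    by (simp only: Re_sum sum_distrib_right)
  also have "\<dots> = 0" by (simp add: sum2)
  finally have "(\<Sum>i<n. Re ((z i)\<^sup>2 * (cnj m)\<^sup>2)) = 0" .
  then have r2: "(\<Sum>i<n. (r i)\<^sup>2) = n * (R\<^sup>2 * (cmod m)\<^sup>2) / 2"
    by (simp add: rsq sum.distrib flip: sum_divide_distrib)
  show "(\<Sum>i<n. cmod (m - z i) ^ 2) = n * (R\<^sup>2 + (cmod m)\<^sup>2)"
    using r1 by (simp add: d sum_subtractf T_def flip: sum_distrib_left)
  have "(\<Sum>i<n. cmod (m - z i) ^ 4) = (\<Sum>i<n. T\<^sup>2 - 4 * T * r i + 4 * (r i)\<^sup>2)"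
  proof (rule sum.cong)
    fix i assume "i \<in> {..<n}"
    then have "cmod (m - z i) ^ 4 = (T - 2 * r i)\<^sup>2"
      using d[of i] power_mult[of "cmod (m - z i)" 2 2] by simp
    then show "cmod (m - z i) ^ 4 = T\<^sup>2 - 4 * T * r i + 4 * (r i)\<^sup>2"
      by (simp add: power2_eq_square algebra_simps)
  qed simp
  also have "\<dots> = n * (T\<^sup>2 + 2 * R\<^sup>2 * (cmod m)\<^sup>2)"
    by (simp add: sum.distrib sum_subtractf r1 r2 distrib_left flip: sum_distrib_left)
  finally show "(\<Sum>i<n. cmod (m - z i) ^ 4) =
      n * ((R\<^sup>2 + (cmod m)\<^sup>2)\<^sup>2 + 2 * R\<^sup>2 * (cmod m)\<^sup>2)" by (simp add: T_def)
qed

text \<open>As \<open>3 \<le> n\<close>, index \<open>i + 2\<close> modulo \<open>n\<close> is not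
  an endpoint of side \<open>i\<close>, so convexity makes the determinant nonzero. A coincidence
  with \<open>A i\<close> would give it a zero row.\<close>

lemma convex_polygon_distinct:
  assumes "convex_polygon n A" "i < n"
  shows "A ((i + 1) mod n) \<noteq> A i" and "A ((i + 2) mod n) \<noteq> A i"
proof -
  define p q r where "p = A i" and "q = A ((i + 1) mod n)" and "r = A ((i + 2) mod n)"
  have n: "3 \<le> n" using assms(1) by (simp add: convex_polygon_def)
  have "(i + 2) mod n \<noteq> i" "(i + 2) mod n \<noteq> (i + 1) mod n"
    using n assms(2) by (auto simp: mod_if)
  then have "(i + 2) mod n \<in> {..<n} - {i, (i + 1) mod n}" using n by auto
  then have "det (vector [q - p, r - p] :: real^2^2) \<noteq> 0"
    using assms unfolding convex_polygon_def Let_def p_def q_def r_def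
    by (metis less_irrefl)
  then have "q \<noteq> p" "r \<noteq> p" by (auto simp: det_2)
  then show "A ((i + 1) mod n) \<noteq> A i" "A ((i + 2) mod n) \<noteq> A i"
    by (simp_all add: p_def q_def r_def)
qed

text \<open>The first sum identifies the circumcentre \<open>c\<close> with the centroid; the second
  enters through the fourth powers of the distances.\<close>

lemma regular_polygon_vertex_sums:
  assumes reg: "regular_polygon n A" and circ: "\<And>i. i < n \<Longrightarrow> dist c (A i) = R"
  defines "z \<equiv> \<lambda>i. complex_of_vec (A i) - complex_of_vec c"
  shows "(\<Sum>i<n. z i) = 0" and "(\<Sum>i<n. (z i)\<^sup>2) = 0"
proof -
  have conv: "convex_polygon n A" and equi: "equilateral_polygon n A"
    using reg by (auto simp: regular_polygon_def)
  have n: "3 \<le> n" using conv by (simp add: convex_polygon_def)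
  obtain s where s: "\<And>i. i < n \<Longrightarrow> dist (A i) (A ((i + 1) mod n)) = s"
    using equi by (auto simp: equilateral_polygon_def)
  \<comment> \<open>The periodic extension lets the recurrence hold at every index; its period later
    forces \<open>q ^ n = 1\<close>.\<close>
  define w where "w i = z (i mod n)" for i
  have norm: "cmod (w i) = R" for i
    using circ[of "i mod n"] n by (simp add: w_def z_def dist_complex_of_vec norm_minus_commute)
  have side: "cmod (w i - w (i + 1)) = s" for i
    using s[of "i mod n"] n by (simp add: w_def z_def dist_complex_of_vec mod_simps)
  have distinct: "w (i + 1) \<noteq> w i" "w (i + 2) \<noteq> w i" for i
    using convex_polygon_distinct[OF conv, of "i mod n"] n
    by (simp_all add: w_def z_def inj_complex_of_vec mod_simps)
  have nz: "w i \<noteq> 0" for i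
  proof
    \<comment> \<open>Then \<open>R = 0\<close>, which collapses adjacent vertices onto the
      centre.\<close>
    assume "w i = 0"
    with norm[of i] norm[of "i + 1"] distinct(1)[of i] show False by simp
  qed
  have "w i * w (i + 2) = (w (i + 1))\<^sup>2" for i
  proof (rule circle_neighbours_mult[where R = R and s = s])
    show "cmod (w (i + 2) - w (i + 1)) = s"
      using side[of "i + 1"] by (simp add: norm_minus_commute)
  qed (use norm side distinct(2)[of i] in auto)
  note geom = geometric_of_mult_eq_square[of w, OF nz this]
  define q where "q = w 1 / w 0"
  have wq: "w i = w 0 * q ^ i" for i using geom[of i] by (simp add: q_def)
  have "w n = w 0" by (simp add: w_def)
  with wq[of n] nz[of 0] have qn: "q ^ n = 1" by simp
  have q1: "q \<noteq> 1" using distinct(1)[of 0] nz[of 0] by (simp add: q_def)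
  \<comment> \<open>Otherwise \<open>w 2 = w 0\<close>, although vertices two steps apart
    differ.\<close>
  have q2: "q\<^sup>2 \<noteq> 1"
    using distinct(2)[of 0] wq[of 2] by (auto simp del: One_nat_def simp: numeral_2_eq_2)
  have zw: "z i = w 0 * q ^ i" if "i < n" for i using that wq[of i] by (simp add: w_def)
  show "(\<Sum>i<n. z i) = 0"
    using sum_powers_root_of_unity[OF qn q1] by (simp add: zw flip: sum_distrib_left)
  have "(q\<^sup>2) ^ n = 1" using qn by (metis mult.commute power_mult power_one)
  moreover have "(z i)\<^sup>2 = (w 0)\<^sup>2 * (q\<^sup>2) ^ i" if "i < n" for i
    by (simp add: zw[OF that] power_mult_distrib mult.commute flip: power_mult)
  ultimately show "(\<Sum>i<n. (z i)\<^sup>2) = 0"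
    using sum_powers_root_of_unity[of "q\<^sup>2" n] q2 by (simp flip: sum_distrib_left)
qed

theorem theorem4p3:
  fixes n :: nat and A :: "nat \<Rightarrow> real^2" and M :: "real^2" and R L S2 S4 :: real
  assumes "n \<ge> 3"
    and "regular_polygon n A"
    and "R > 0" and "has_circumradius n A R"
    and "L = dist M (centroid n A)"
    and "S2 = cyclic_average n A M 1"
    and "S4 = cyclic_average n A M 2"
  shows "3 * S2^2 - 2 * S4 \<ge> 0 \<and>
    ((R^2 = 1/2 * (S2 + sqrt (3 * S2^2 - 2 * S4)) \<and>
      L^2 = 1/2 * (S2 - sqrt (3 * S2^2 - 2 * S4))) \<or>
     (R^2 = 1/2 * (S2 - sqrt (3 * S2^2 - 2 * S4)) \<and>
      L^2 = 1/2 * (S2 + sqrt (3 * S2^2 - 2 * S4))))"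
proof -
  obtain c where c: "\<And>i. i < n \<Longrightarrow> dist c (A i) = R"
    using assms(4) by (auto simp: has_circumradius_def)
  define z where "z i = complex_of_vec (A i) - complex_of_vec c" for i
  define m where "m = complex_of_vec M - complex_of_vec c"
  note sums = regular_polygon_vertex_sums[OF assms(2) c, folded z_def]
  have "complex_of_vec (\<Sum>i<n. A i) = of_nat n * complex_of_vec c"
    using sums(1) by (simp add: z_def sum_subtractf linear_sum[OF linear_complex_of_vec])
  then have "complex_of_vec (centroid n A) = complex_of_vec c"
    using assms(1) by (simp add: centroid_def linear_scale[OF linear_complex_of_vec]
        scaleR_conv_of_real[where 'a = complex])
  then have L: "L = cmod m" using assms(5) by (simp add: dist_complex_of_vec m_def)
  have d: "dist M (A i) = cmod (m - z i)" for i
    by (simp add: dist_complex_of_vec m_def z_def)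
  have zR: "cmod (z i) = R" if "i < n" for i
    using c[OF that] by (simp add: z_def dist_complex_of_vec norm_minus_commute)
  note mom = circle_moments[OF zR sums, where m = m]
  have S2: "S2 = R\<^sup>2 + L\<^sup>2"
    using assms(1,6) mom(1) by (simp add: cyclic_average_def d L)
  have S4: "S4 = (R\<^sup>2 + L\<^sup>2)\<^sup>2 + 2 * R\<^sup>2 * L\<^sup>2"
    using assms(1,7) mom(2) by (simp add: cyclic_average_def d L)
  have disc: "3 * S2\<^sup>2 - 2 * S4 = (R\<^sup>2 - L\<^sup>2)\<^sup>2"
    by (simp add: S2 S4 power2_eq_square algebra_simps)
  \<comment> \<open>The root is the absolute value of \<open>R\<^sup>2 - L\<^sup>2\<close>: the
    upper signs hold when \<open>M\<close> lies inside or on the circumcircle, the lower ones when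
    it lies outside.\<close>
  show ?thesis unfolding disc using S2 by (cases "L\<^sup>2 \<le> R\<^sup>2") auto
qed

end
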